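(* Let $B_n$ be the closed unit Euclidean ball in $\mathbb{R}^n$ centered at the origin. If $1\le n\le 4$, then $$\theta_n(B_n)=\|P'\|_{B_n},$$ where $\theta_n(B_n)$ is the minimal norm $\|P\|_{B_n}$ of an interpolation projector $P:C(B_n)\to\Pi_1(\mathbb{R}^n)$ with nodes in $B_n$, and $P'$ is an interpolation projector whose nodes coincide with the vertices of a regular simplex inscribed into $B_n$.
   Context: $C(B_n)$ is the space of continuous functions $f:B_n\to\mathbb{R}$ with norm $\|f\|_{C(B_n)}=\max_{x\in B_n}|f(x)|$. $\Pi_1(\mathbb{R}^n)$ is the set of polynomials in $n$ variables of degree $\le 1$. The interpolation projector $P:C(B_n)\to\Pi_1(\mathbb{R}^n)$ with nodes $x^{(1)},\dots,x^{(n+1)}\in B_n$ (the vertices of a nondegenerate $n$-dimensional simplex) is defined by $Pf(x^{(j)})=f(x^{(j)})$, $j=1,\dots,n+1$. $\|P\|_{B_n}$ denotes the norm of $P$ as an operator from $C(B_n)$ to $C(B_n)$. A simplex is inscribed into $B_n$ if all its vertices lie on the boundary sphere (for $n=1$, the simplex is the segment $[-1,1]$). The norm $\|P'\|_{B_n}$ does not depend on the choice of the regular simplex inscribed into $B_n$. *)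

theory Defs
  imports "HOL-Analysis.Analysis"
begin

abbreviation unit_ball :: "(real ^ 'n) set" where
  "unit_ball \<equiv> cball 0 1"

text \<open>Elements of \<open>C(B\<^sub>n)\<close> are functions on \<open>\<real>\<^sup>n\<close> that are continuous on the unit ball;
  their values off the ball are irrelevant.\<close>

definition C_ball :: "(real ^ 'n \<Rightarrow> real) set" where
  "C_ball = {f. continuous_on unit_ball f}"

definition C_norm :: "(real ^ 'n \<Rightarrow> real) \<Rightarrow> real" where
  "C_norm f = (SUP x\<in>unit_ball. \<bar>f x\<bar>)"

lemma C_norm_is_max:
  fixes f :: "real ^ 'n \<Rightarrow> real"
  assumes "f \<in> C_ball"
  shows "\<exists>x\<in>unit_ball. C_norm f = \<bar>f x\<bar> \<and> (\<forall>y\<in>unit_ball. \<bar>f y\<bar> \<le> \<bar>f x\<bar>)"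
proof -
  have "continuous_on unit_ball (\<lambda>x. \<bar>f x\<bar>)"
    using assms unfolding C_ball_def by (auto intro: continuous_intros)
  then obtain x where x: "x \<in> unit_ball" "\<forall>y\<in>unit_ball. \<bar>f y\<bar> \<le> \<bar>f x\<bar>"
    using continuous_attains_sup[of "unit_ball :: (real ^ 'n) set" "\<lambda>x. \<bar>f x\<bar>"] by auto
  then have "C_norm f = \<bar>f x\<bar>"
    unfolding C_norm_def by (intro cSup_eq_maximum) auto
  with x show ?thesis by blast
qed

definition Pi1 :: "(real ^ 'n \<Rightarrow> real) set" where
  "Pi1 = {p. \<exists>c a. \<forall>x. p x = c + (\<Sum>i\<in>UNIV. a i * x $ i)}"

text \<open>An interpolation projector depends only on the set of its nodes, not on their order,
  so the nodes are given as a set of \<open>n + 1\<close> affinely independent points.\<close>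

definition simplex_vertices :: "(real ^ 'n) set \<Rightarrow> bool" where
  "simplex_vertices N \<longleftrightarrow>
     finite N \<and> card N = CARD('n) + 1 \<and> \<not> affine_dependent N"

definition interpolation_projector ::
    "(real ^ 'n) set \<Rightarrow> ((real ^ 'n \<Rightarrow> real) \<Rightarrow> (real ^ 'n \<Rightarrow> real)) \<Rightarrow> bool" where
  "interpolation_projector N P \<longleftrightarrow>
     simplex_vertices N \<and> N \<subseteq> unit_ball \<and>
     (\<forall>f\<in>C_ball. P f \<in> Pi1 \<and> (\<forall>x\<in>N. P f x = f x))"

definition operator_norm ::
    "((real ^ 'n \<Rightarrow> real) \<Rightarrow> (real ^ 'n \<Rightarrow> real)) \<Rightarrow> real" where
  "operator_norm P = (SUP f\<in>{f \<in> C_ball. C_norm f \<le> 1}. C_norm (P f))"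

lemma operator_norm_bdd_above:
  fixes N :: "(real ^ 'n) set"
  assumes "interpolation_projector N P"
  shows "bdd_above ((\<lambda>f. C_norm (P f)) ` {f \<in> C_ball. C_norm f \<le> 1})"
proof -
  have N: "finite N" "card N = Suc (DIM(real ^ 'n))" "\<not> affine_dependent N" "N \<subseteq> unit_ball"
    using assms by (auto simp: interpolation_projector_def simplex_vertices_def)
  then have "interior (convex hull N) \<noteq> {}"
    by (simp add: interior_convex_hull_eq_empty)
  then obtain z where "z \<in> interior (convex hull N)" by blast
  then obtain r where r: "r > 0" "cball z r \<subseteq> convex hull N"
    using mem_interior_cball by blast
  have bound: "C_norm (P f) \<le> 1 + 4 / r" if f: "f \<in> C_ball" "C_norm f \<le> 1" for f
  proof -
    from assms f(1) have "P f \<in> Pi1" and PN: "\<And>x. x \<in> N \<Longrightarrow> P f x = f x"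
      by (auto simp: interpolation_projector_def)
    then obtain c a where "\<And>x. P f x = c + (\<Sum>i\<in>UNIV. a i * x $ i)"
      unfolding Pi1_def by blast
    then have p: "P f x = c + (\<chi> i. a i) \<bullet> x" for x
      by (simp add: inner_vec_def)
    define q where "q = (\<chi> i. a i)"
    have "N \<subseteq> {x. q \<bullet> x \<le> 1 - c} \<inter> {x. q \<bullet> x \<ge> - 1 - c}"
    proof
      fix x assume x: "x \<in> N"
      have "\<bar>f x\<bar> \<le> 1"
        using C_norm_is_max[OF f(1)] f(2) N(4) x by force
      with PN[OF x] p[of x] show "x \<in> {x. q \<bullet> x \<le> 1 - c} \<inter> {x. q \<bullet> x \<ge> - 1 - c}"
        unfolding q_def Int_iff mem_Collect_eq by linarith
    qed
    then have "convex hull N \<subseteq> {x. q \<bullet> x \<le> 1 - c} \<inter> {x. q \<bullet> x \<ge> - 1 - c}"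
      by (intro hull_minimal convex_Int convex_halfspace_le convex_halfspace_ge)
    with r(2) have b: "\<bar>c + q \<bullet> y\<bar> \<le> 1" if "y \<in> cball z r" for y
      using that by fastforce
    have zN: "norm z \<le> 1"
      using r N(4) hull_minimal[of N unit_ball convex] centre_in_cball[of z r]
      by (force simp: convex_cball)
    show ?thesis
      unfolding C_norm_def
    proof (rule cSUP_least)
      fix x :: "real ^ 'n" assume "x \<in> unit_ball"
      then have "norm (x - z) \<le> 2"
        using zN norm_triangle_ineq4[of x z] by auto
      then have "norm ((r / 2) *\<^sub>R (x - z)) \<le> r"
        using r(1) unfolding norm_scaleR by simp
      then have "z + (r / 2) *\<^sub>R (x - z) \<in> cball z r"
        unfolding mem_cball dist_norm by (metis add_diff_cancel_left' norm_minus_commute)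
      from b[OF this] b[of z] r(1)
      have "\<bar>(r / 2) * (q \<bullet> (x - z))\<bar> \<le> 2"
        by (simp add: inner_add_right)
      then have "\<bar>q \<bullet> (x - z)\<bar> \<le> 4 / r"
        using r(1) by (simp add: abs_mult field_simps)
      moreover have "P f x = (c + q \<bullet> z) + q \<bullet> (x - z)"
        by (simp add: p q_def inner_diff_right)
      ultimately show "\<bar>P f x\<bar> \<le> 1 + 4 / r"
        using b[of z] r(1) by auto
    qed auto
  qed
  then show ?thesis
    by (auto simp: bdd_above_def)
qed

text \<open>The dimension \<open>n = CARD('n)\<close> is passed through the type of the (otherwise unused) argument.
  All operator norms are nonnegative, so the infimum is a genuine one, and an equation
  \<open>theta TYPE('n) = operator_norm P\<close> for a projector \<open>P\<close> says that the minimum is attained at \<open>P\<close>.\<close>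

definition theta :: "'n::finite itself \<Rightarrow> real" where
  "theta _ = Inf {operator_norm P | (P :: (real ^ 'n \<Rightarrow> real) \<Rightarrow> (real ^ 'n \<Rightarrow> real)) N.
                    interpolation_projector N P}"

definition regular_simplex_vertices :: "(real ^ 'n) set \<Rightarrow> bool" where
  "regular_simplex_vertices N \<longleftrightarrow>
     simplex_vertices N \<and> (\<exists>d. \<forall>x\<in>N. \<forall>y\<in>N. x \<noteq> y \<longrightarrow> dist x y = d)"

end

theory Submission imports Defs begin

text \<open>
  Put \<open>n = CARD('n)\<close>. Both sides equal \<open>(3n - 1) / (n + 1)\<close>. For nodes \<open>N\<close>, let \<open>\<lambda>\<^sub>v\<close> be the
  barycentric coordinate of the node \<open>v\<close>: the affine function with value \<open>1\<close> at \<open>v\<close> and \<open>0\<close> at the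
  other nodes; \<open>g\<^sub>v\<close> denotes its gradient.

  Lower bound, for every projector (\<open>operator_norm_lower_bound\<close>). The affine functions
  \<open>1 - 2 \<lambda>\<^sub>v\<close> interpolate data \<open>\<plusminus>1\<close>, and at the point \<open>- g\<^sub>v / \<bar>g\<^sub>v\<bar>\<close> of the ball such a function
  is \<open>1 - 2 \<lambda>\<^sub>v(0) + 2 \<bar>g\<^sub>v\<bar>\<close>, so the norm of the projector is at least that. Sum this over the
  \<open>n + 1\<close> nodes: \<open>\<Sum> \<lambda>\<^sub>v(0) = 1\<close>, while \<open>e = \<Sum> (g\<^sub>v \<bullet> e) v\<close> writes the identity map as a sum of
  rank-one maps, whose traces give \<open>n = \<Sum> g\<^sub>v \<bullet> v \<le> \<Sum> \<bar>g\<^sub>v\<bar>\<close> because the nodes lie in the ball.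
  (Geometrically, \<open>1 / \<bar>g\<^sub>v\<bar>\<close> is the height of the simplex over the facet opposite to \<open>v\<close>, and the
  last inequality says that the inradius is at most \<open>1 / n\<close>.)

  Upper bound, for a regular inscribed simplex (\<open>operator_norm_regular_upper_bound\<close>). The norm is
  at most the maximum of \<open>\<Sum> \<bar>\<lambda>\<^sub>v(x)\<bar>\<close> over the ball, and now \<open>\<lambda>\<^sub>v(x) = (1 + n v \<bullet> x) / (n + 1)\<close>.
  If \<open>t\<close> coordinates of \<open>x\<close> are negative, the sum is \<open>1\<close> minus twice those \<open>t\<close> coordinates, so it
  depends on the inner product of \<open>x\<close> with a sum of \<open>t\<close> vertices, whose length is
  \<open>sqrt (t (n + 1 - t) / n)\<close>. The desired bound becomes
  \<open>n t (n + 1 - t) \<le> (n - 1 + t)\<^sup>2\<close>. The difference of the two sides is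
  \<open>(t - 1) ((n + 1) t - (n - 1)\<^sup>2)\<close>; it is a square at \<open>t = 0\<close>, vanishes at
  \<open>t = 1\<close>, and is nonnegative for all integers \<open>t \<ge> 2\<close> exactly when \<open>n \<le> 4\<close>.
\<close>

section \<open>Affine functions and barycentric coordinates\<close>

lemma simplex_barycentric_coordinates:
  fixes N :: "(real ^ 'n) set"
  assumes "simplex_vertices N"
  obtains u where "sum u N = 1" and "(\<Sum>v\<in>N. u v *\<^sub>R v) = x"
proof -
  have fin: "finite N" and c: "card N = Suc (DIM(real ^ 'n))" "\<not> affine_dependent N"
    using assms by (auto simp: simplex_vertices_def)
  have "x \<in> affine hull N"
    using affine_independent_span_eq[OF c(2,1)] by simp
  then show thesis
    unfolding affine_hull_finite[OF fin] using that by blast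
qed

lemma Pi1_gradient:
  assumes "p \<in> Pi1"
  shows "\<exists>c g. \<forall>x. p x = c + g \<bullet> x"
proof -
  obtain c a where "\<And>x. p x = c + (\<Sum>i\<in>UNIV. a i * x $ i)"
    using assms unfolding Pi1_def by blast
  then have "\<forall>x. p x = c + (\<chi> i. a i) \<bullet> x"
    by (simp add: inner_vec_def)
  then show ?thesis by blast
qed

lemma Pi1_subset_C_ball: "Pi1 \<subseteq> C_ball"
proof
  fix p :: "real ^ 'n \<Rightarrow> real" assume "p \<in> Pi1"
  then obtain c g where "\<forall>x. p x = c + g \<bullet> x" using Pi1_gradient by blast
  then have "p = (\<lambda>x. c + g \<bullet> x)" by (intro ext) simp
  then show "p \<in> C_ball" by (auto simp: C_ball_def intro!: continuous_intros)
qed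

lemma Pi1_affine_combination:
  assumes "p \<in> Pi1" and "sum u N = 1"
  shows "p (\<Sum>v\<in>N. u v *\<^sub>R v) = (\<Sum>v\<in>N. u v * p v)"
proof -
  obtain c g where g: "\<forall>x. p x = c + g \<bullet> x" using Pi1_gradient[OF assms(1)] by blast
  have "p (\<Sum>v\<in>N. u v *\<^sub>R v) = sum u N * c + (\<Sum>v\<in>N. u v * (g \<bullet> v))"
    using assms(2) by (simp add: g inner_sum_right)
  also have "\<dots> = (\<Sum>v\<in>N. u v * p v)"
    by (simp add: g sum_distrib_right sum.distrib distrib_left)
  finally show ?thesis .
qed

text \<open>Taking traces in \<open>e = \<Sum> (g\<^sub>v \<bullet> e) v\<close>.\<close>

lemma trace_resolution_of_identity:
  fixes g :: "'a::euclidean_space \<Rightarrow> 'a"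
  assumes "\<And>e. (\<Sum>v\<in>N. (g v \<bullet> e) *\<^sub>R v) = e"
  shows "(\<Sum>v\<in>N. g v \<bullet> v) = DIM('a)"
proof -
  have "(\<Sum>v\<in>N. g v \<bullet> v) = (\<Sum>v\<in>N. \<Sum>b\<in>Basis. (g v \<bullet> b) * (v \<bullet> b))"
    by (intro sum.cong refl euclidean_inner)
  also have "\<dots> = (\<Sum>b\<in>Basis. (\<Sum>v\<in>N. (g v \<bullet> b) *\<^sub>R v) \<bullet> b)"
    by (subst sum.swap) (simp add: inner_sum_left)
  also have "\<dots> = DIM('a)"
    by (simp add: assms)
  finally show ?thesis .
qed

section \<open>The lower bound\<close>

lemma interpolation_abs_le_operator_norm:
  assumes "interpolation_projector N P" and f: "f \<in> C_ball" "\<And>y. \<bar>f y\<bar> \<le> 1"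
    and x: "x \<in> unit_ball"
  shows "\<bar>P f x\<bar> \<le> operator_norm P"
proof -
  have "P f \<in> C_ball"
    using assms(1) f(1) Pi1_subset_C_ball by (auto simp: interpolation_projector_def)
  then have "\<bar>P f x\<bar> \<le> C_norm (P f)"
    using C_norm_is_max x by metis
  moreover have "C_norm f \<le> 1"
    using C_norm_is_max[OF f(1)] f(2) by auto
  then have "C_norm (P f) \<le> operator_norm P"
    unfolding operator_norm_def
    using f(1) by (intro cSUP_upper operator_norm_bdd_above[OF assms(1)]) auto
  ultimately show ?thesis by linarith
qed

text \<open>Interpolating a narrow downward spike at the node \<open>v\<close> produces the affine function
  \<open>1 - 2 \<lambda>\<^sub>v\<close>. So the projector itself supplies the barycentric coordinates, together with a bound
  by its norm.\<close>

lemma obtain_spike_interpolant: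
  fixes N :: "(real ^ 'n) set"
  assumes P: "interpolation_projector N P" and v: "v \<in> N"
  obtains p where "p \<in> Pi1" and "\<And>w. w \<in> N \<Longrightarrow> p w = (if w = v then -1 else 1)"
    and "\<And>x. x \<in> unit_ball \<Longrightarrow> \<bar>p x\<bar> \<le> operator_norm P"
proof -
  have "finite N" using P by (auto simp: interpolation_projector_def simplex_vertices_def)
  then obtain d where d: "d > 0" "\<And>w. w \<in> N \<Longrightarrow> w \<noteq> v \<Longrightarrow> d \<le> dist v w"
    using finite_set_avoid[of N v] by blast
  define f where "f x = 1 - 2 * max 0 (1 - dist v x / d)" for x
  have "f \<in> C_ball"
    unfolding C_ball_def f_def using d(1) by (auto intro!: continuous_intros)
  moreover have "\<bar>f x\<bar> \<le> 1" for x
  proof -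
    have "0 \<le> max 0 (1 - dist v x / d)" "max 0 (1 - dist v x / d) \<le> 1"
      using d(1) by simp_all
    moreover have "\<bar>1 - 2 * m\<bar> \<le> 1" if "0 \<le> m" "m \<le> 1" for m :: real
      using that by linarith
    ultimately show ?thesis unfolding f_def by blast
  qed
  moreover have "f w = (if w = v then -1 else 1)" if "w \<in> N" for w
    unfolding f_def using d(1) d(2)[OF that] by (auto simp: max_def)
  ultimately show thesis
    using P interpolation_abs_le_operator_norm[OF P]
    by (intro that[of "P f"]) (auto simp: interpolation_projector_def)
qed

theorem operator_norm_lower_bound:
  fixes N :: "(real ^ 'n) set"
  assumes P: "interpolation_projector N P"
  shows "(3 * real CARD('n) - 1) / (real CARD('n) + 1) \<le> operator_norm P"
proof -
  define n where "n = real CARD('n)"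
  have S: "simplex_vertices N" and NB: "N \<subseteq> unit_ball"
    using P by (auto simp: interpolation_projector_def)
  have fin: "finite N" and card: "real (card N) = n + 1"
    using S by (auto simp: simplex_vertices_def n_def)
  have "\<exists>p. p \<in> Pi1 \<and> (\<forall>w\<in>N. p w = (if w = v then -1 else 1)) \<and>
          (\<forall>x\<in>unit_ball. \<bar>p x\<bar> \<le> operator_norm P)" if "v \<in> N" for v
    using obtain_spike_interpolant[OF P that] by metis
  then obtain p where p: "\<And>v. v \<in> N \<Longrightarrow> p v \<in> Pi1"
      "\<And>v w. v \<in> N \<Longrightarrow> w \<in> N \<Longrightarrow> p v w = (if w = v then -1 else 1)"
      "\<And>v x. v \<in> N \<Longrightarrow> x \<in> unit_ball \<Longrightarrow> \<bar>p v x\<bar> \<le> operator_norm P"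
    by metis
  have "\<exists>c g. \<forall>x. p v x = c + g \<bullet> x" if "v \<in> N" for v
    by (rule Pi1_gradient[OF p(1)[OF that]])
  then obtain c h where h: "\<And>v x. v \<in> N \<Longrightarrow> p v x = c v + h v \<bullet> x"
    by metis
  define g where "g v = (-1/2) *\<^sub>R h v" for v
  define b where "b v = (1 - c v) / 2" for v
  have pg: "p v x = 1 - 2 * (b v + g v \<bullet> x)" if "v \<in> N" for v x
    using h[OF that, of x] by (simp add: g_def b_def field_simps)
  have coord: "(\<Sum>v\<in>N. b v + g v \<bullet> x) = 1" "(\<Sum>v\<in>N. (b v + g v \<bullet> x) *\<^sub>R v) = x" for x
  proof -
    obtain u where u: "sum u N = 1" "(\<Sum>v\<in>N. u v *\<^sub>R v) = x"
      using simplex_barycentric_coordinates[OF S] .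
    have "b v + g v \<bullet> x = u v" if "v \<in> N" for v
    proof -
      have "p v x = (\<Sum>w\<in>N. u w * p v w)"
        using Pi1_affine_combination[OF p(1)[OF that] u(1)] u(2) by simp
      also have "\<dots> = (\<Sum>w\<in>N. u w - (if w = v then 2 * u w else 0))"
        by (rule sum.cong) (auto simp: p(2)[OF that])
      also have "\<dots> = 1 - 2 * u v"
        using u(1) fin that by (simp add: sum_subtractf)
      finally show ?thesis using pg[OF that, of x] by simp
    qed
    then show "(\<Sum>v\<in>N. b v + g v \<bullet> x) = 1" "(\<Sum>v\<in>N. (b v + g v \<bullet> x) *\<^sub>R v) = x"
      using u by simp_all
  qed
  have sum_b: "sum b N = 1"
    using coord(1)[of 0] by simp
  have "(\<Sum>v\<in>N. (g v \<bullet> e) *\<^sub>R v) = e" for e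
    using coord(2)[of e] coord(2)[of 0] by (simp add: scaleR_add_left sum.distrib)
  then have "n = (\<Sum>v\<in>N. g v \<bullet> v)"
    using trace_resolution_of_identity[of g N] by (simp add: n_def)
  also have "\<dots> \<le> (\<Sum>v\<in>N. norm (g v))"
  proof (rule sum_mono)
    fix v assume "v \<in> N"
    then have "norm (g v) * norm v \<le> norm (g v)"
      using NB by (intro mult_left_le) auto
    then show "g v \<bullet> v \<le> norm (g v)"
      using norm_cauchy_schwarz[of "g v" v] by linarith
  qed
  finally have sum_g: "n \<le> (\<Sum>v\<in>N. norm (g v))" .
  have "3 * n - 1 \<le> (\<Sum>v\<in>N. 1 - 2 * b v + 2 * norm (g v))"
    using sum_b sum_g card by (simp add: sum.distrib sum_subtractf flip: sum_distrib_left)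
  also have "\<dots> \<le> (\<Sum>v\<in>N. operator_norm P)"
  proof (rule sum_mono)
    fix v assume v: "v \<in> N"
    \<comment> \<open>The ball attains the minimum of \<open>\<lambda>\<^sub>v\<close> at \<open>- sgn (g v)\<close>; a vanishing gradient is covered by
      \<open>sgn 0 = 0\<close>.\<close>
    have "g v \<bullet> sgn (g v) = norm (g v)"
      by (cases "g v = 0") (simp_all add: sgn_div_norm dot_square_norm power2_eq_square)
    then have "p v (- sgn (g v)) = 1 - 2 * b v + 2 * norm (g v)"
      by (simp add: pg[OF v])
    moreover have "- sgn (g v) \<in> unit_ball"
      by (simp add: norm_sgn)
    ultimately show "1 - 2 * b v + 2 * norm (g v) \<le> operator_norm P"
      using p(3)[OF v] by (metis abs_le_D1)
  qed
  also have "\<dots> = (n + 1) * operator_norm P"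
    using card by simp
  finally show ?thesis
    by (simp add: n_def field_simps)
qed

section \<open>The regular simplex\<close>

text \<open>The sum of the vertices has the same inner product with every vertex, hence with every point
  of the affine hull, which is the whole space; such a vector is zero. That determines the common
  inner product of two vertices.\<close>

lemma regular_simplex_inner:
  fixes N :: "(real ^ 'n) set"
  assumes "regular_simplex_vertices N" and "N \<subseteq> sphere 0 1"
    and "v \<in> N" "w \<in> N" "v \<noteq> w"
  shows "v \<bullet> w = - 1 / real CARD('n)"
proof -
  have S: "simplex_vertices N"
    using assms(1) by (simp add: regular_simplex_vertices_def)
  then have fin: "finite N" and card: "card N = CARD('n) + 1"
    by (auto simp: simplex_vertices_def)
  obtain d where d: "\<forall>x\<in>N. \<forall>y\<in>N. x \<noteq> y \<longrightarrow> dist x y = d"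
    using assms(1) unfolding regular_simplex_vertices_def by (elim conjE exE)
  define k where "k = 1 - d\<^sup>2 / 2"
  have k: "x \<bullet> y = (if x = y then 1 else k)" if "x \<in> N" "y \<in> N" for x y
  proof -
    have norms: "norm x = 1" "norm y = 1" using that assms(2) by auto
    show ?thesis
    proof (cases "x = y")
      case True
      then show ?thesis using norms by (simp add: dot_square_norm)
    next
      case False
      then have "norm (x - y) = d" using d that by (simp add: dist_norm)
      then have "x \<bullet> y = (1 + 1 - d\<^sup>2) / 2"
        using dot_norm_neg[of x y] norms by simp
      then show ?thesis using False by (simp add: k_def)
    qed
  qed
  define s where "s = (\<Sum>y\<in>N. y)"
  have sv: "s \<bullet> x = 1 + real CARD('n) * k" if "x \<in> N" for x
  proof -
    have "s \<bullet> x = (\<Sum>y\<in>N. if y = x then 1 else k)"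
      unfolding s_def inner_sum_left using k[OF _ that] by (intro sum.cong) auto
    also have "\<dots> = 1 + real CARD('n) * k"
      using fin that card by (simp add: sum.remove[of N x])
    finally show ?thesis .
  qed
  have const: "s \<bullet> x = 1 + real CARD('n) * k" for x
  proof -
    obtain u where u: "sum u N = 1" "(\<Sum>y\<in>N. u y *\<^sub>R y) = x"
      using simplex_barycentric_coordinates[OF S] .
    have "s \<bullet> x = (\<Sum>y\<in>N. u y * (s \<bullet> y))"
      by (simp add: inner_sum_right flip: u(2))
    also have "\<dots> = 1 + real CARD('n) * k"
      using u(1) by (simp add: sv flip: sum_distrib_right)
    finally show ?thesis .
  qed
  have "real CARD('n) * k = -1"
    using const[of 0] by simp
  then show ?thesis
    using k[of v w] assms(3-5) by (simp add: field_simps)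
qed

text \<open>Between the vertices the inner product is \<open>(1 + 1 / n) \<delta> - 1 / n\<close>, so pairing the barycentric
  expansion of \<open>x\<close> with \<open>v\<close> isolates the coefficient of \<open>v\<close>.\<close>

lemma regular_simplex_coordinate:
  fixes N :: "(real ^ 'n) set"
  assumes reg: "regular_simplex_vertices N" "N \<subseteq> sphere 0 1"
    and u: "sum u N = 1" "(\<Sum>w\<in>N. u w *\<^sub>R w) = x" and v: "v \<in> N"
  shows "u v = (1 + real CARD('n) * (v \<bullet> x)) / (real CARD('n) + 1)"
proof -
  define n where "n = real CARD('n)"
  have n: "n > 0" by (simp add: n_def)
  have fin: "finite N"
    using reg(1) by (simp add: regular_simplex_vertices_def simplex_vertices_def)
  have vv: "v \<bullet> v = 1"
    using v reg(2) by (auto simp flip: power2_norm_eq_inner)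
  have "v \<bullet> x = (\<Sum>w\<in>N. u w * (v \<bullet> w))"
    by (simp add: inner_sum_right flip: u(2))
  also have "\<dots> = (\<Sum>w\<in>N. (if w = v then u w * (1 + 1 / n) else 0) - u w / n)"
    using regular_simplex_inner[OF reg v] vv
    by (intro sum.cong) (auto simp: n_def algebra_simps)
  also have "\<dots> = u v * (1 + 1 / n) - 1 / n"
    using fin v u(1) by (simp add: sum_subtractf flip: sum_divide_distrib)
  also have "\<dots> = (u v * (n + 1) - 1) / n"
    using n by (simp add: field_simps)
  finally show ?thesis
    using n unfolding n_def[symmetric] by (simp add: field_simps)
qed

lemma regular_simplex_norm_vertex_sum:
  fixes N :: "(real ^ 'n) set"
  assumes reg: "regular_simplex_vertices N" "N \<subseteq> sphere 0 1" and T: "T \<subseteq> N"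
  shows "(norm (\<Sum>v\<in>T. v))\<^sup>2 = card T * (real CARD('n) + 1 - card T) / CARD('n)"
proof -
  define n where "n = real CARD('n)"
  have n: "n > 0" by (simp add: n_def)
  have fin: "finite T"
    using reg(1) T finite_subset
    by (auto simp: regular_simplex_vertices_def simplex_vertices_def)
  have "(norm (\<Sum>v\<in>T. v))\<^sup>2 = (\<Sum>v\<in>T. \<Sum>w\<in>T. v \<bullet> w)"
    by (simp add: power2_norm_eq_inner inner_sum_left inner_sum_right) (rule sum.swap)
  also have "\<dots> = (\<Sum>v\<in>T. \<Sum>w\<in>T. (if w = v then 1 + 1 / n else 0) - 1 / n)"
  proof (intro sum.cong refl)
    fix v w assume "v \<in> T" "w \<in> T"
    moreover from this have "v \<bullet> v = 1"
      using T reg(2) by (auto simp flip: power2_norm_eq_inner)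
    ultimately show "v \<bullet> w = (if w = v then 1 + 1 / n else 0) - 1 / n"
      using regular_simplex_inner[OF reg, of v w] T by (auto simp: n_def)
  qed
  also have "\<dots> = card T * (1 + 1 / n) - card T * (card T / n)"
    using fin by (simp add: sum_subtractf right_diff_distrib)
  also have "\<dots> = card T * (n + 1 - card T) / n"
    using n by (simp add: field_simps)
  finally show ?thesis by (simp add: n_def)
qed

text \<open>This is where the dimension is restricted: at \<open>t = 2\<close> the inequality reads \<open>n\<^sup>2 - 4 n \<le> 1\<close>, which
  holds for \<open>n = 4\<close> and fails for \<open>n = 5\<close>.\<close>

lemma sign_count_inequality:
  fixes n t :: nat
  assumes "n \<le> 4"
  shows "real n * t * (real n + 1 - t) \<le> (real n - 1 + t)\<^sup>2"
proof -
  have diff: "(real n - 1 + t)\<^sup>2 - real n * t * (real n + 1 - t) =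
      (real t - 1) * ((real n + 1) * t - (real n - 1)\<^sup>2)"
    by (simp add: power2_eq_square algebra_simps)
  consider "t = 0" | "t = 1" | "t \<ge> 2" by linarith
  then show ?thesis
  proof cases
    case 3
    have "n \<in> {0, 1, 2, 3, 4}" using assms by auto
    then have "(real n - 1)\<^sup>2 \<le> (real n + 1) * 2"
      by auto
    also have "\<dots> \<le> (real n + 1) * t"
      using 3 by (intro mult_left_mono) auto
    finally have "0 \<le> (real t - 1) * ((real n + 1) * t - (real n - 1)\<^sup>2)"
      using 3 by (intro mult_nonneg_nonneg) auto
    then show ?thesis using diff by linarith
  qed (use diff in auto)
qed

theorem operator_norm_regular_upper_bound:
  fixes N :: "(real ^ 'n) set"
  assumes dim: "CARD('n) \<le> 4"
    and reg: "regular_simplex_vertices N" "N \<subseteq> sphere 0 1"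
    and P: "interpolation_projector N P"
  shows "operator_norm P \<le> (3 * real CARD('n) - 1) / (real CARD('n) + 1)"
proof -
  define n where "n = real CARD('n)"
  have n: "n \<ge> 1" by (simp add: n_def Suc_leI)
  have S: "simplex_vertices N" and NB: "N \<subseteq> unit_ball"
    using P by (auto simp: interpolation_projector_def)
  have fin: "finite N" using S by (simp add: simplex_vertices_def)
  have point: "\<bar>P f x\<bar> \<le> (3 * n - 1) / (n + 1)"
    if f: "f \<in> C_ball" "C_norm f \<le> 1" and x: "x \<in> unit_ball" for f x
  proof -
    obtain u where u: "sum u N = 1" "(\<Sum>v\<in>N. u v *\<^sub>R v) = x"
      using simplex_barycentric_coordinates[OF S] .
    define T where "T = {v \<in> N. u v < 0}"
    have "P f x = (\<Sum>v\<in>N. u v * f v)"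
      using Pi1_affine_combination[OF _ u(1), of "P f"] P f(1) u(2)
      by (simp add: interpolation_projector_def)
    also have "\<bar>\<dots>\<bar> \<le> (\<Sum>v\<in>N. \<bar>u v * f v\<bar>)"
      by (rule sum_abs)
    also have "\<dots> \<le> (\<Sum>v\<in>N. \<bar>u v\<bar>)"
    proof (rule sum_mono)
      fix v assume "v \<in> N"
      then have "\<bar>f v\<bar> \<le> 1"
        using C_norm_is_max[OF f(1)] f(2) NB by force
      then show "\<bar>u v * f v\<bar> \<le> \<bar>u v\<bar>"
        by (simp add: abs_mult mult_left_le)
    qed
    also have "\<dots> = (\<Sum>v\<in>N. u v - 2 * (if u v < 0 then u v else 0))"
      by (rule sum.cong) auto
    also have "\<dots> = 1 - 2 * sum u T"
      using u(1) fin
      by (simp add: sum_subtractf T_def sum.inter_filter flip: sum_distrib_left)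
    also have "sum u T = (\<Sum>v\<in>T. (1 + n * (v \<bullet> x)) / (n + 1))"
      using regular_simplex_coordinate[OF reg u] unfolding n_def T_def
      by (intro sum.cong) auto
    also have "\<dots> = (card T + n * ((\<Sum>v\<in>T. v) \<bullet> x)) / (n + 1)"
      by (simp add: sum.distrib inner_sum_left sum_distrib_left flip: sum_divide_distrib)
    also have "1 - 2 * \<dots> \<le> (3 * n - 1) / (n + 1)"
    proof -
      let ?s = "norm (\<Sum>v\<in>T. v)"
      have "(n * ?s)\<^sup>2 = n\<^sup>2 * (card T * (n + 1 - card T) / n)"
        using regular_simplex_norm_vertex_sum[OF reg, of T]
        by (simp add: T_def n_def power_mult_distrib)
      also have "\<dots> = n * card T * (n + 1 - card T)"
        using n by (simp add: power2_eq_square)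
      also have "\<dots> \<le> (n - 1 + card T)\<^sup>2"
        using sign_count_inequality[OF dim] by (simp add: n_def)
      finally have "n * ?s \<le> n - 1 + card T"
        by (rule power2_le_imp_le) (use n in simp)
      moreover have "- ((\<Sum>v\<in>T. v) \<bullet> x) \<le> ?s"
      proof -
        have "?s * norm x \<le> ?s" using x by (intro mult_left_le) auto
        then show ?thesis
          using Cauchy_Schwarz_ineq2[of "\<Sum>v\<in>T. v" x] by linarith
      qed
      then have "n * - ((\<Sum>v\<in>T. v) \<bullet> x) \<le> n * ?s"
        using n by (intro mult_left_mono) auto
      ultimately have "n + 1 - 2 * (card T + n * ((\<Sum>v\<in>T. v) \<bullet> x)) \<le> 3 * n - 1"
        by simp
      then have "(n + 1 - 2 * (card T + n * ((\<Sum>v\<in>T. v) \<bullet> x))) / (n + 1) \<le> (3 * n - 1) / (n + 1)"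
        using n by (intro divide_right_mono) auto
      then show ?thesis
        using n by (simp add: diff_divide_distrib)
    qed
    finally show ?thesis .
  qed
  have "(\<lambda>x. 0) \<in> {f :: real ^ 'n \<Rightarrow> real. f \<in> C_ball \<and> C_norm f \<le> 1}"
    by (simp add: C_ball_def C_norm_def)
  then have "{f :: real ^ 'n \<Rightarrow> real. f \<in> C_ball \<and> C_norm f \<le> 1} \<noteq> {}" by blast
  moreover have "C_norm (P f) \<le> (3 * n - 1) / (n + 1)" if "f \<in> C_ball" "C_norm f \<le> 1" for f
    unfolding C_norm_def by (rule cSUP_least) (use point[OF that] in auto)
  ultimately show ?thesis
    unfolding operator_norm_def n_def[symmetric] by (intro cSUP_least) auto
qed

theorem corollary3:
  fixes N :: "(real ^ 'n) set"
    and P' :: "(real ^ 'n \<Rightarrow> real) \<Rightarrow> (real ^ 'n \<Rightarrow> real)"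
  assumes "1 \<le> CARD('n)" and "CARD('n) \<le> 4"
    and "regular_simplex_vertices N" and "N \<subseteq> sphere 0 1"
    and "interpolation_projector N P'"
  shows "theta TYPE('n) = operator_norm P'"
  unfolding theta_def
proof (rule cInf_eq_minimum)
  show "operator_norm P' \<in> {operator_norm P | (P :: (real ^ 'n \<Rightarrow> real) \<Rightarrow> (real ^ 'n \<Rightarrow> real)) N.
      interpolation_projector N P}"
    using assms(5) by blast
next
  fix y assume "y \<in> {operator_norm P | (P :: (real ^ 'n \<Rightarrow> real) \<Rightarrow> (real ^ 'n \<Rightarrow> real)) N.
      interpolation_projector N P}"
  then show "operator_norm P' \<le> y"
    using operator_norm_regular_upper_bound[OF assms(2-5)] operator_norm_lower_bound by fastforce
qed

end
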